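(* Let $N=(\Gamma,B)$ be a network with $\Gamma=(V,E)$, and let $d=|V|$ and $n=|V\setminus B|$. Write the chromatic polynomial of $\Gamma$ and the precoloring polynomial of $N$ as $\chi_\Gamma(\lambda)=a_0\lambda^d-a_1\lambda^{d-1}+\cdots+(-1)^da_d$ and $\bar\chi_{M(N)}(\lambda)=b_0\lambda^n-b_1\lambda^{n-1}+\cdots+(-1)^nb_n$. Then $a_i\ge b_i$ for all $i=0,\dots,n$, with $a_i=b_i$ whenever $i$ is less than the minimum number of edges in a path in $\Gamma$ between distinct boundary nodes.
   Context: A network $N=(\Gamma,B)$ consists of a finite connected graph $\Gamma=(V,E)$ with no loops or multiple edges and a set $B\subsetneq V$ of at least 2 vertices (boundary nodes), no two of which are adjacent; vertices in $V\setminus B$ are interior. The Dirichlet matroid $M(N)$: fix an injective $u:B\to\mathbb{R}$ and a new symbol $e_0\notin E$; in $\mathbb{R}^{(V\setminus B)\cup\{0\}}$ assign to each edge $ij$ with $i,j$ interior the vector $\mathbf{e}_i-\mathbf{e}_j$, to each edge $ij$ with $i$ interior and $j\in B$ the vector $\mathbf{e}_i-u(j)\mathbf{e}_0$, and to $e_0$ the vector $\mathbf{e}_0$; $M(N)$ is the matroid of linear independence of these vectors on $E\cup\{e_0\}$ (independent of the choice of injective $u$). The precoloring polynomial of $N$ is the reduced characteristic polynomial $\bar\chi_{M(N)}(\lambda)=\chi_{M(N)}(\lambda)/(\lambda-1)$, where $\chi_{M(N)}$ is the characteristic polynomial of the matroid $M(N)$. $\chi_\Gamma$ is the chromatic polynomial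 of $\Gamma$. *)

theory Defs
  imports
    "HOL-Analysis.Finite_Function_Topology"
    "HOL-Computational_Algebra.Polynomial"
begin

section \<open>Graphs\<close>

definition simple_graph :: "'a set \<Rightarrow> 'a set set \<Rightarrow> bool" where
  "simple_graph V E \<longleftrightarrow> (\<forall>e\<in>E. e \<subseteq> V \<and> card e = 2)"

text \<open>A path is given by its list of vertices and has \<open>length p - 1\<close> edges.\<close>

definition graph_path :: "'a set \<Rightarrow> 'a set set \<Rightarrow> 'a list \<Rightarrow> bool" where
  "graph_path V E p \<longleftrightarrow>
     p \<noteq> [] \<and> set p \<subseteq> V \<and> distinct p \<and> successively (\<lambda>x y. {x, y} \<in> E) p"

definition graph_connected :: "'a set \<Rightarrow> 'a set set \<Rightarrow> bool" where
  "graph_connected V E \<longleftrightarrow>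
     V \<noteq> {} \<and> (\<forall>x\<in>V. \<forall>y\<in>V. \<exists>p. graph_path V E p \<and> hd p = x \<and> last p = y)"

definition proper_colorings :: "'a set \<Rightarrow> 'a set set \<Rightarrow> nat \<Rightarrow> ('a \<Rightarrow> nat) set" where
  "proper_colorings V E k =
     {c \<in> V \<rightarrow>\<^sub>E {..<k}. \<forall>x\<in>V. \<forall>y\<in>V. {x, y} \<in> E \<longrightarrow> c x \<noteq> c y}"

definition chromatic_poly :: "'a set \<Rightarrow> 'a set set \<Rightarrow> int poly" where
  "chromatic_poly V E =
     (THE p. \<forall>k. poly p (int k) = int (card (proper_colorings V E k)))"


section \<open>Matroids\<close>

text \<open>A matroid is represented by its ground set together with its independence predicate.\<close>

type_synonym 'e matroid = "'e set \<times> ('e set \<Rightarrow> bool)"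

definition vector_matroid :: "'e set \<Rightarrow> ('e \<Rightarrow> 'v::real_vector) \<Rightarrow> 'e matroid" where
  "vector_matroid S v = (S, \<lambda>I. I \<subseteq> S \<and> inj_on v I \<and> independent (v ` I))"

definition matroid_rank :: "'e matroid \<Rightarrow> 'e set \<Rightarrow> nat" where
  "matroid_rank M A = Max (card ` {I. I \<subseteq> A \<and> snd M I})"

definition characteristic_poly :: "'e matroid \<Rightarrow> int poly" where
  "characteristic_poly M = (\<Sum>A\<in>Pow (fst M).
     monom ((-1) ^ card A) (matroid_rank M (fst M) - matroid_rank M A))"

definition reduced_characteristic_poly :: "'e matroid \<Rightarrow> int poly" where
  "reduced_characteristic_poly M = characteristic_poly M div [:-1, 1:]"

text \<open>The division is exact for every matroid on a nonempty finite ground set.\<close>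

lemma characteristic_poly_eq_reduced:
  assumes "finite (fst M)" "fst M \<noteq> {}"
  shows "characteristic_poly M = reduced_characteristic_poly M * [:-1, 1:]"
proof -
  have "poly (characteristic_poly M) 1 = (\<Sum>A\<in>Pow (fst M). (-1) ^ card A)"
    by (simp add: characteristic_poly_def poly_sum poly_monom)
  also have "\<dots> = (\<Prod>x\<in>fst M. (1::int) - 1)"
    using prod_diff_conv_sum[OF assms(1), of "\<lambda>_. 1::int" "\<lambda>_. 1"] by simp
  also have "\<dots> = 0"
    using assms by (simp add: card_gt_0_iff)
  finally have "[:-1, 1:] dvd characteristic_poly M"
    by (simp add: poly_eq_0_iff_dvd)
  then show ?thesis
    unfolding reduced_characteristic_poly_def by (rule dvd_div_mult_self[symmetric])
qed


section \<open>Networks and the Dirichlet matroid\<close>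

definition network :: "'a set \<Rightarrow> 'a set set \<Rightarrow> 'a set \<Rightarrow> bool" where
  "network V E B \<longleftrightarrow>
     finite V \<and> simple_graph V E \<and> graph_connected V E \<and>
     B \<subset> V \<and> card B \<ge> 2 \<and> (\<forall>x\<in>B. \<forall>y\<in>B. {x, y} \<notin> E)"

definition boundary_distance :: "'a set \<Rightarrow> 'a set set \<Rightarrow> 'a set \<Rightarrow> nat" where
  "boundary_distance V E B =
     (LEAST k. \<exists>p. graph_path V E p \<and> hd p \<in> B \<and> last p \<in> B \<and> hd p \<noteq> last p \<and>
                   k = length p - 1)"

text \<open>
  Coordinates are indexed by \<open>'a option\<close>: \<open>Some i\<close> is the coordinate of the interior vertex
  \<open>i\<close>, and \<open>None\<close> is the extra coordinate \<open>0\<close>. All vectors used below are supported on the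
  interior vertices and the extra coordinate.
\<close>

abbreviation basis_vec :: "'a option \<Rightarrow> 'a option \<Rightarrow>\<^sub>0 real" where
  "basis_vec k \<equiv> Poly_Mapping.single k 1"

text \<open>
  Ground set elements are likewise \<open>Some e\<close> for an edge \<open>e\<close>, and \<open>None\<close> for the new symbol
  \<open>e\<^sub>0\<close>. For an edge \<open>{i, j}\<close> with both ends interior, the choice operator picks one of the two
  vectors \<open>e\<^sub>i - e\<^sub>j\<close> and \<open>e\<^sub>j - e\<^sub>i\<close>; for an edge with an end in \<open>B\<close> there is exactly one
  candidate.
\<close>

fun dirichlet_vec ::
  "'a set \<Rightarrow> 'a set \<Rightarrow> ('a \<Rightarrow> real) \<Rightarrow> 'a set option \<Rightarrow> 'a option \<Rightarrow>\<^sub>0 real" where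
  "dirichlet_vec V B u None = basis_vec None"
| "dirichlet_vec V B u (Some e) = (SOME w.
     (\<exists>i\<in>V - B. \<exists>j\<in>V - B. e = {i, j} \<and> w = basis_vec (Some i) - basis_vec (Some j)) \<or>
     (\<exists>i\<in>V - B. \<exists>j\<in>B. e = {i, j} \<and> w = basis_vec (Some i) - u j *\<^sub>R basis_vec None))"

definition dirichlet_matroid ::
  "'a set \<Rightarrow> 'a set set \<Rightarrow> 'a set \<Rightarrow> ('a \<Rightarrow> real) \<Rightarrow> 'a set option matroid" where
  "dirichlet_matroid V E B u = vector_matroid (insert None (Some ` E)) (dirichlet_vec V B u)"

definition precoloring_poly ::
  "'a set \<Rightarrow> 'a set set \<Rightarrow> 'a set \<Rightarrow> ('a \<Rightarrow> real) \<Rightarrow> int poly" where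
  "precoloring_poly V E B u = reduced_characteristic_poly (dirichlet_matroid V E B u)"

end

theory Submission
  imports Defs
begin

text \<open>
  By inclusion-exclusion the chromatic polynomial is the sum of \<open>(-1)^|A| \<lambda>^c(A)\<close> over all \<open>A \<subseteq> E\<close>,
  where \<open>c(A)\<close> is the number of components of \<open>(V, A)\<close>. In the characteristic polynomial of the
  Dirichlet matroid the terms of \<open>A\<close> and \<open>A \<union> {e\<^sub>0}\<close> cancel if \<open>e\<^sub>0\<close> lies in the span of \<open>A\<close>, which
  happens exactly when \<open>A\<close> connects two boundary nodes; all other \<open>A\<close> have rank \<open>d - c(A)\<close>. Hence
  \<open>a\<^sub>i - b\<^sub>i\<close> is \<open>(-1)^i\<close> times the sum of \<open>(-1)^|A|\<close> over those \<open>A\<close> with \<open>d - c(A) = i\<close> that connect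
  two boundary nodes. Such \<open>A\<close> contain a path between boundary nodes, so there are none if \<open>i\<close> is
  smaller than the boundary distance, and the sum has sign \<open>(-1)^i\<close> by deletion-contraction.
\<close>

section \<open>Connected components of an edge set\<close>

definition component :: "'a set set \<Rightarrow> 'a \<Rightarrow> 'a set" where
  "component A x = {y. (\<lambda>x y. {x, y} \<in> A)\<^sup>*\<^sup>* x y}"

text \<open>\<open>component\<close> knows the edges only, so the vertex set enters here; an
  isolated vertex contributes its singleton.\<close>

definition component_set :: "'a set \<Rightarrow> 'a set set \<Rightarrow> 'a set set" where
  "component_set V A = component A ` V"

lemma component_refl [simp]: "x \<in> component A x"
  by (simp add: component_def)

lemma component_sym: "y \<in> component A x \<Longrightarrow> x \<in> component A y"
  using sympD[OF symp_rtranclp, of "\<lambda>x y. {x, y} \<in> A"]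
  by (auto simp: component_def symp_def insert_commute)

lemma component_trans: "y \<in> component A x \<Longrightarrow> z \<in> component A y \<Longrightarrow> z \<in> component A x"
  by (auto simp: component_def)

lemma component_eqI: "y \<in> component A x \<Longrightarrow> component A y = component A x"
  by (intro equalityI subsetI) (metis component_trans, metis component_sym component_trans)

lemma component_eq_iff: "component A x = component A y \<longleftrightarrow> y \<in> component A x"
  by (metis component_eqI component_refl)

lemma component_edge: "{x, y} \<in> A \<Longrightarrow> y \<in> component A x"
  by (auto simp: component_def)

text \<open>Reachability induction in set form: upper bounds on a component are obtained by
  exhibiting a set closed under the edges.\<close>

lemma component_subset:
  assumes "\<And>y z. y \<in> S \<Longrightarrow> {y, z} \<in> A \<Longrightarrow> z \<in> S" and "x \<in> S"
  shows "component A x \<subseteq> S"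
proof
  fix y assume "y \<in> component A x"
  then have "(\<lambda>x y. {x, y} \<in> A)\<^sup>*\<^sup>* x y" by (simp add: component_def)
  then show "y \<in> S" by induction (rule assms(2), rule assms(1))
qed

lemma component_mono:
  assumes "A \<subseteq> A'"
  shows "component A x \<subseteq> component A' x"
proof (rule component_subset)
  fix y z assume *: "y \<in> component A' x" "{y, z} \<in> A"
  then have "{y, z} \<in> A'" using assms by blast
  then show "z \<in> component A' x" by (rule component_trans[OF *(1) component_edge])
qed simp

text \<open>Basis of the edge-by-edge arguments below. The formula also covers an edge inside one
  component, where the union is that component again.\<close>

lemma component_insert:
  "component (insert {i, j} A) x =
     (if x \<in> component A i \<union> component A j then component A i \<union> component A j
      else component A x)"
proof -
  let ?A = "insert {i, j} A"
  have mono: "component A y \<subseteq> component ?A y" for y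
    by (rule component_mono) auto
  have ij: "component ?A i = component ?A j"
    by (simp add: component_eq_iff component_edge)
  show ?thesis
  proof (cases "x \<in> component A i \<union> component A j")
    case True
    then have "x \<in> component ?A i \<or> x \<in> component ?A j"
      using mono[of i] mono[of j] by auto
    then have "component ?A x = component ?A i"
      using ij component_eqI[of x ?A i] component_eqI[of x ?A j] by metis
    moreover have "component ?A i \<subseteq> component A i \<union> component A j"
      by (rule component_subset)
        (auto simp: doubleton_eq_iff intro: component_trans[OF _ component_edge])
    moreover have "component A i \<union> component A j \<subseteq> component ?A i"
      using mono[of i] mono[of j] ij by auto
    ultimately show ?thesis using True by auto
  next
    case False
    have "component ?A x \<subseteq> component A x"
    proof (rule component_subset)
      fix y z assume *: "y \<in> component A x" "{y, z} \<in> ?A"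
      then have "y \<noteq> i" "y \<noteq> j" using False component_sym[of y A x] by auto
      then have "{y, z} \<in> A" using * by (auto simp: doubleton_eq_iff)
      then show "z \<in> component A x" by (rule component_trans[OF *(1) component_edge])
    qed simp
    then show ?thesis using False mono[of x] by auto
  qed
qed

lemma component_insert_redundant:
  "j \<in> component A i \<Longrightarrow> component (insert {i, j} A) = component A"
  by (rule ext) (auto simp: component_insert component_eqI)

lemma component_empty: "component {} x = {x}"
  using component_subset[of "{x}" "{}" x] by auto

lemma component_set_empty: "component_set V {} = (\<lambda>x. {x}) ` V"
  by (simp add: component_set_def component_empty)

lemma card_component_set_empty: "card (component_set V {}) = card V"
  by (simp add: component_set_empty card_image)

lemma component_set_insert:
  assumes "i \<in> V" "j \<in> V"
  shows "component_set V (insert {i, j} A) = insert (component A i \<union> component A j)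
    (component_set V A - {component A i, component A j})"
proof -
  let ?I = "component A i" and ?J = "component A j" and ?A = "insert {i, j} A"
  have merged: "component ?A x = ?I \<union> ?J" if "x \<in> ?I \<union> ?J" for x
    unfolding component_insert using that by (rule if_P)
  have kept: "component ?A x = component A x" "component A x \<notin> {?I, ?J}" if "x \<notin> ?I \<union> ?J" for x
    unfolding component_insert using that component_refl[of x A] by (metis, blast)
  show ?thesis
  proof (intro equalityI subsetI)
    fix X assume "X \<in> component_set V ?A"
    then obtain x where x: "x \<in> V" "X = component ?A x"
      unfolding component_set_def by (rule imageE)
    show "X \<in> insert (?I \<union> ?J) (component_set V A - {?I, ?J})"
    proof (cases "x \<in> ?I \<union> ?J")
      case True
      show ?thesis unfolding x(2) merged[OF True] by (rule insertI1)
    next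
      case False
      show ?thesis
        unfolding x(2) kept(1)[OF False] component_set_def
        by (intro insertI2 DiffI imageI x(1) kept(2) False)
    qed
  next
    fix X assume "X \<in> insert (?I \<union> ?J) (component_set V A - {?I, ?J})"
    then show "X \<in> component_set V ?A"
    proof (elim insertE DiffE)
      assume "X = ?I \<union> ?J"
      then have "X = component ?A i" using merged[of i] by simp
      then show ?thesis using assms(1) unfolding component_set_def by (rule image_eqI)
    next
      assume X: "X \<in> component_set V A" "X \<notin> {?I, ?J}"
      then obtain x where x: "x \<in> V" "X = component A x"
        unfolding component_set_def by (elim imageE)
      have "x \<notin> ?I \<union> ?J"
        using X(2) x(2) component_eqI[of x A i] component_eqI[of x A j] by auto
      then have "X = component ?A x" unfolding x(2) using kept(1) by simp
      then show ?thesis using x(1) unfolding component_set_def by (rule image_eqI)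
    qed
  qed
qed

lemma card_component_set_insert:
  assumes "finite V" "i \<in> V" "j \<in> V"
  shows "card (component_set V A) =
    (if j \<in> component A i then card (component_set V (insert {i, j} A))
     else Suc (card (component_set V (insert {i, j} A))))"
proof (cases "j \<in> component A i")
  case True
  then show ?thesis by (simp add: component_set_def component_insert_redundant)
next
  case False
  let ?I = "component A i" and ?J = "component A j"
  let ?R = "component_set V A - {?I, ?J}"
  have fin: "finite (component_set V A)" using assms(1) by (simp add: component_set_def)
  \<comment> \<open>An old component equal to the union would contain both \<open>i\<close> and
    \<open>j\<close> and so connect them already. The merged class is therefore new: two components
    leave, one arrives.\<close>
  have "?I \<union> ?J \<notin> component_set V A"
  proof
    assume "?I \<union> ?J \<in> component_set V A"
    then obtain x where x: "?I \<union> ?J = component A x"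
      unfolding component_set_def by blast
    have "i \<in> component A x" "j \<in> component A x"
      using x component_refl[of i A] component_refl[of j A] by blast+
    then show False using False component_eqI[of i A x] by simp
  qed
  then have "card (insert (?I \<union> ?J) ?R) = Suc (card ?R)"
    using fin by (intro card_insert_disjoint) blast+
  moreover have "card {?I, ?J} = 2"
    using False component_refl[of j A] by (metis card_2_iff)
  moreover have sub: "{?I, ?J} \<subseteq> component_set V A"
    unfolding component_set_def using assms by blast
  then have "card ?R = card (component_set V A) - card {?I, ?J}"
    using fin by (intro card_Diff_subset) simp_all
  moreover have "card {?I, ?J} \<le> card (component_set V A)"
    by (rule card_mono[OF fin sub])
  ultimately show ?thesis
    unfolding component_set_insert[OF assms(2,3)] using False by presburger
qed

lemma card_component_set_le: "finite V \<Longrightarrow> card (component_set V A) \<le> card V"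
  by (simp add: component_set_def card_image_le)

text \<open>All of \<open>S\<close> accounts for one component, and every vertex outside
  \<open>S\<close> for at most one more. Applied to the vertices of a path, this bounds the number
  of components by its length.\<close>

lemma card_component_set_add_card_component_le:
  assumes "finite V" "x \<in> V" "S \<subseteq> V" "S \<subseteq> component A x"
  shows "card (component_set V A) + card S \<le> Suc (card V)"
proof -
  have "component_set V A \<subseteq> insert (component A x) (component A ` (V - S))"
  proof
    fix X assume "X \<in> component_set V A"
    then obtain y where "y \<in> V" "X = component A y" by (auto simp: component_set_def)
    then show "X \<in> insert (component A x) (component A ` (V - S))"
      using assms(4) component_eqI[of y A x] by (cases "y \<in> S") auto
  qed
  moreover have "finite (V - S)" using assms by simp
  ultimately have "card (component_set V A) \<le> card (insert (component A x) (component A ` (V - S)))"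
    by (metis card_mono finite_imageI finite_insert)
  also have "\<dots> \<le> Suc (card (component A ` (V - S)))"
    by (metis card_insert_if \<open>finite (V - S)\<close> finite_imageI le_SucI order_refl)
  also have "card (component A ` (V - S)) \<le> card (V - S)"
    using \<open>finite (V - S)\<close> by (rule card_image_le)
  also have "card (V - S) = card V - card S"
    using assms(1,3) by (intro card_Diff_subset finite_subset[of S V])
  finally show ?thesis using card_mono[OF assms(1,3)] by linarith
qed

lemma component_path:
  assumes "y \<in> component A x" "x \<in> V" "\<Union>A \<subseteq> V"
  obtains p where "graph_path V A p" "hd p = x" "last p = y" "set p \<subseteq> component A x"
proof -
  have "(\<lambda>x y. {x, y} \<in> A)\<^sup>*\<^sup>* x y" using assms by (simp add: component_def)
  then have "\<exists>p. graph_path V A p \<and> hd p = x \<and> last p = y \<and> set p \<subseteq> component A x"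
  proof induction
    case base
    then show ?case using assms by (intro exI[of _ "[x]"]) (simp add: graph_path_def)
  next
    case (step y z)
    then obtain p where p: "graph_path V A p" "hd p = x" "last p = y" "set p \<subseteq> component A x"
      by blast
    show ?case
    proof (cases "z \<in> set p")
      case True
      \<comment> \<open>Appending a vertex that was visited before would destroy distinctness; the
        path is cut at its earlier visit to \<open>z\<close> instead.\<close>
      then obtain xs ys where "p = xs @ z # ys" by (meson split_list)
      then have "graph_path V A (xs @ [z]) \<and> hd (xs @ [z]) = x \<and> set (xs @ [z]) \<subseteq> component A x"
        using p by (auto simp: graph_path_def successively_append_iff hd_append)
      then show ?thesis by (intro exI[of _ "xs @ [z]"]) simp
    next
      case False
      have "z \<in> V" using step assms by auto
      moreover have "z \<in> component A x"
        using step.hyps by (simp add: component_def rtranclp.rtrancl_into_rtrancl)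
      ultimately show ?thesis using p step False
        by (intro exI[of _ "p @ [z]"])
          (auto simp: graph_path_def successively_append_iff)
    qed
  qed
  then show ?thesis using that by blast
qed

lemma component_of_path:
  "successively (\<lambda>x y. {x, y} \<in> A) p \<Longrightarrow> p \<noteq> [] \<Longrightarrow> last p \<in> component A (hd p)"
proof (induction p rule: induct_list012)
  case (3 x y zs)
  then show ?case using component_trans[OF component_edge[of x y A]] by simp
qed auto

section \<open>Alternating sums over edge sets\<close>

text \<open>
  Deletion-contraction: the set \<open>W\<close> collects the edges contracted so far, and contracting an edge
  flips the sign exactly when it merges two components of \<open>W\<close>; otherwise the sum vanishes.
\<close>

lemma signed_component_sum_nonneg:
  fixes P :: "('a \<Rightarrow> 'a set) \<Rightarrow> bool"
  assumes V: "finite V" and "finite F" and "\<And>e. e \<in> F \<Longrightarrow> \<exists>i\<in>V. \<exists>j\<in>V. e = {i, j}"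
  shows "0 \<le> (-1) ^ (card (component_set V W) + m) *
    (\<Sum>A\<in>{A\<in>Pow F. P (component (A \<union> W)) \<and> card (component_set V (A \<union> W)) = m}. (-1::int) ^ card A)"
    (is "0 \<le> _ * sum _ (?S F W)")
  using assms(2,3)
proof (induction F arbitrary: W)
  case empty
  have "?S {} W = (if P (component W) \<and> card (component_set V W) = m then {{}} else {})"
    by auto
  \<comment> \<open>If the sum is nonempty, its sign exponent is \<open>m + m\<close>, hence
    even.\<close>
  then show ?case by (simp flip: mult_2)
next
  case (insert e F)
  obtain i j where e: "e = {i, j}" "i \<in> V" "j \<in> V" using insert.prems by blast
  let ?D = "\<lambda>F W. \<Sum>A\<in>?S F W. (-1::int) ^ card A"
  \<comment> \<open>The subsets containing \<open>e\<close> are indexed by what remains after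
    removing \<open>e\<close>, which moves over to the contracted set \<open>W\<close>.\<close>
  have split: "?S (insert e F) W = ?S F W \<union> insert e ` ?S F (insert e W)"
  proof -
    have "{A \<in> X \<union> insert e ` X. Q A} = {A \<in> X. Q A} \<union> insert e ` {A \<in> X. Q (insert e A)}"
      for Q :: "'a set set \<Rightarrow> bool" and X
      by blast
    from this[of "Pow F" "\<lambda>A. P (component (A \<union> W)) \<and> card (component_set V (A \<union> W)) = m"]
    show ?thesis by (simp add: Pow_insert)
  qed
  have "?D (insert e F) W = ?D F W + (\<Sum>A\<in>insert e ` ?S F (insert e W). (-1) ^ card A)"
    unfolding split using insert.hyps by (intro sum.union_disjoint) auto
  also have "(\<Sum>A\<in>insert e ` ?S F (insert e W). (-1::int) ^ card A)
      = (\<Sum>A\<in>?S F (insert e W). (-1) ^ card (insert e A))"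
    using insert.hyps by (subst sum.reindex) (auto simp: inj_on_def)
  also have "\<dots> = - ?D F (insert e W)"
    unfolding sum_negf[symmetric]
  proof (rule sum.cong)
    fix A assume "A \<in> ?S F (insert e W)"
    then have "finite A" "e \<notin> A" using insert.hyps finite_subset by auto
    then show "(-1::int) ^ card (insert e A) = - ((-1) ^ card A)" by simp
  qed simp
  finally have D: "?D (insert e F) W = ?D F W - ?D F (insert e W)" by simp
  have IH: "0 \<le> (-1) ^ (card (component_set V W') + m) * ?D F W'" for W'
    using insert by blast
  show ?case
  proof (cases "j \<in> component W i")
    case True
    \<comment> \<open>\<open>P\<close> and the component count see \<open>A\<close> only through its
      component function, so both index sets agree and the difference vanishes.\<close>
    have "component (insert e (A \<union> W)) = component (A \<union> W)" for A
      unfolding e using True component_mono[of W "A \<union> W" i]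
      by (intro component_insert_redundant) auto
    then have "?S F (insert e W) = ?S F W"
      by (simp add: component_set_def)
    then show ?thesis unfolding D by simp
  next
    case False
    have "card (component_set V W) = Suc (card (component_set V (insert e W)))"
      using card_component_set_insert[OF V e(2,3), of W] False e by simp
    then show ?thesis
      using IH[of W] IH[of "insert e W"] unfolding D by (simp add: algebra_simps)
  qed
qed

section \<open>Subset expansion of the chromatic polynomial\<close>

lemma prod_of_bool:
  "finite A \<Longrightarrow> (\<Prod>x\<in>A. of_bool (P x)) = (of_bool (\<forall>x\<in>A. P x) :: 'b::comm_semiring_1)"
  by (induction A rule: finite_induct) auto

text \<open>A coloring constant along edges is constant on components, hence the same as a free
  coloring of the component set; \<open>?\<phi>\<close> is this bijection.\<close>

lemma card_monochromatic_colorings: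
  assumes V: "finite V" and A: "\<And>e. e \<in> A \<Longrightarrow> e \<subseteq> V"
  shows "card {c \<in> V \<rightarrow>\<^sub>E {..<k}. \<forall>x\<in>V. \<forall>y\<in>V. {x, y} \<in> A \<longrightarrow> c x = c y} =
    k ^ card (component_set V A)" (is "card ?C = _")
proof -
  let ?P = "component_set V A \<rightarrow>\<^sub>E {..<k}"
  let ?\<phi> = "\<lambda>g. restrict (\<lambda>x. g (component A x)) V"
  have inj: "inj_on ?\<phi> ?P"
  proof (rule inj_onI)
    fix g h assume gh: "g \<in> ?P" "h \<in> ?P" "?\<phi> g = ?\<phi> h"
    show "g = h"
    proof (rule PiE_ext[OF gh(1,2)])
      fix X assume "X \<in> component_set V A"
      then obtain x where "x \<in> V" "X = component A x" by (auto simp: component_set_def)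
      then show "g X = h X" using fun_cong[OF gh(3), of x] by simp
    qed
  qed
  have image: "?\<phi> ` ?P = ?C"
  proof (intro equalityI subsetI)
    fix c assume "c \<in> ?\<phi> ` ?P"
    then show "c \<in> ?C"
      by (auto simp: component_set_def PiE_iff component_eqI[OF component_edge])
  next
    fix c assume c: "c \<in> ?C"
    have const: "c y = c x" "y \<in> V" if "x \<in> V" "y \<in> component A x" for x y
    proof -
      \<comment> \<open>Membership in \<open>V\<close> is part of the invariant because
        \<open>?C\<close> compares colors only between vertices of \<open>V\<close>.\<close>
      have "component A x \<subseteq> {y\<in>V. c y = c x}"
      proof (rule component_subset)
        fix y z assume *: "y \<in> {y\<in>V. c y = c x}" "{y, z} \<in> A"
        then have "z \<in> V" using A[OF *(2)] by simp
        then have "c y = c z" using c * by blast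
        then show "z \<in> {y\<in>V. c y = c x}" using * \<open>z \<in> V\<close> by simp
      qed (use that(1) in simp)
      then show "c y = c x" "y \<in> V" using that(2) by blast+
    qed
    \<comment> \<open>The color of a component is read off at an arbitrary representative;
      \<open>const\<close> makes the choice irrelevant.\<close>
    define g where "g = restrict (\<lambda>X. c (SOME x. x \<in> X)) (component_set V A)"
    have g: "g (component A x) = c x" if "x \<in> V" for x
    proof -
      have "(SOME y. y \<in> component A x) \<in> component A x"
        by (rule someI[of _ x]) simp
      from const(1)[OF that this] show ?thesis
        using that by (simp add: g_def component_set_def)
    qed
    have "g \<in> ?P"
    proof (rule PiE_I)
      fix X assume "X \<in> component_set V A"
      then obtain x where x: "x \<in> V" "X = component A x"
        unfolding component_set_def by blast
      have "c \<in> V \<rightarrow>\<^sub>E {..<k}" using c by simp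
      then have "c x \<in> {..<k}" using x(1) by (rule PiE_mem)
      then show "g X \<in> {..<k}" unfolding x(2) g[OF x(1)] .
    qed (simp add: g_def)
    moreover have "c = ?\<phi> g"
    proof
      fix x
      have "c \<in> V \<rightarrow>\<^sub>E {..<k}" using c by simp
      then have "x \<notin> V \<Longrightarrow> c x = undefined" by (rule PiE_arb)
      then show "c x = ?\<phi> g x" using g[of x] by (simp add: restrict_def)
    qed
    ultimately show "c \<in> ?\<phi> ` ?P" by blast
  qed
  have "card ?C = card ?P" unfolding image[symmetric] by (rule card_image[OF inj])
  also have "\<dots> = k ^ card (component_set V A)"
    using V by (simp add: card_PiE component_set_def)
  finally show ?thesis .
qed

text \<open>Whitney's expansion. The indicator of a proper coloring is the product over the edges of
  1 minus the indicator that the edge is monochromatic. Expanding it and swapping sums leaves, for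
  each \<open>A\<close>, the count of colorings constant along \<open>A\<close>.\<close>

lemma chromatic_poly_expansion:
  assumes V: "finite V" and E: "simple_graph V E"
  shows "chromatic_poly V E = (\<Sum>A\<in>Pow E. monom ((-1) ^ card A) (card (component_set V A)))"
    (is "_ = ?p")
proof -
  have finE: "finite E"
    using V E finite_subset[of E "Pow V"] by (auto simp: simple_graph_def)
  have main: "poly ?p (int k) = int (card (proper_colorings V E k))" for k
  proof -
    let ?F = "V \<rightarrow>\<^sub>E {..<k}"
    \<comment> \<open>Phrased for an edge as a set, so that products can run over \<open>E\<close>;
      \<open>mono_iff\<close> and \<open>proper_iff\<close> translate to vertex pairs.\<close>
    let ?mono = "\<lambda>c e. \<forall>x\<in>e. \<forall>y\<in>e. c x = c y"
    have finF: "finite ?F" using V by (simp add: finite_PiE)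
    have doubleton: "\<exists>x\<in>V. \<exists>y\<in>V. e = {x, y}" if "e \<in> E" for e
    proof -
      have "e \<subseteq> V" "card e = 2" using E that by (simp_all add: simple_graph_def)
      then obtain x y where "e = {x, y}" unfolding card_2_iff by blast
      then show ?thesis using \<open>e \<subseteq> V\<close> by blast
    qed
    have mono_iff: "(\<forall>e\<in>A. ?mono c e) \<longleftrightarrow> (\<forall>x\<in>V. \<forall>y\<in>V. {x, y} \<in> A \<longrightarrow> c x = c y)"
      if A: "A \<subseteq> E" for A and c :: "'a \<Rightarrow> nat"
    proof
      assume *: "\<forall>e\<in>A. ?mono c e"
      show "\<forall>x\<in>V. \<forall>y\<in>V. {x, y} \<in> A \<longrightarrow> c x = c y"
        by (intro ballI impI) (erule *[rule_format]; simp)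
    next
      assume *: "\<forall>x\<in>V. \<forall>y\<in>V. {x, y} \<in> A \<longrightarrow> c x = c y"
      show "\<forall>e\<in>A. ?mono c e"
      proof
        fix e assume "e \<in> A"
        then obtain x y where xy: "x \<in> V" "y \<in> V" "e = {x, y}" using doubleton A by blast
        then have "c x = c y" using * \<open>e \<in> A\<close> by blast
        then show "?mono c e" unfolding xy(3) by simp
      qed
    qed
    have proper_iff: "(\<forall>e\<in>E. \<not> ?mono c e) \<longleftrightarrow> (\<forall>x\<in>V. \<forall>y\<in>V. {x, y} \<in> E \<longrightarrow> c x \<noteq> c y)"
      for c :: "'a \<Rightarrow> nat"
    proof
      assume *: "\<forall>e\<in>E. \<not> ?mono c e"
      show "\<forall>x\<in>V. \<forall>y\<in>V. {x, y} \<in> E \<longrightarrow> c x \<noteq> c y"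
      proof (intro ballI impI)
        fix x y assume "{x, y} \<in> E"
        then have "\<not> ?mono c {x, y}" using * by blast
        then show "c x \<noteq> c y" by auto
      qed
    next
      assume *: "\<forall>x\<in>V. \<forall>y\<in>V. {x, y} \<in> E \<longrightarrow> c x \<noteq> c y"
      show "\<forall>e\<in>E. \<not> ?mono c e"
      proof
        fix e assume "e \<in> E"
        then obtain x y where "x \<in> V" "y \<in> V" "e = {x, y}" using doubleton by blast
        then show "\<not> ?mono c e" using * \<open>e \<in> E\<close> by blast
      qed
    qed
    have "int (card (proper_colorings V E k)) = (\<Sum>c\<in>?F. of_bool (\<forall>e\<in>E. \<not> ?mono c e))"
      unfolding proper_colorings_def proper_iff[symmetric] using finF by (simp add: Int_def)
    also have "\<dots> = (\<Sum>c\<in>?F. \<Prod>e\<in>E. 1 - of_bool (?mono c e))"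
      using finE by (intro sum.cong refl) (simp add: prod_of_bool flip: of_bool_not_iff)
    also have "\<dots> = (\<Sum>c\<in>?F. \<Sum>A\<in>Pow E. (-1) ^ card A * of_bool (\<forall>e\<in>A. ?mono c e))"
      unfolding prod_diff_conv_sum[OF finE]
      by (intro sum.cong refl) (simp add: prod_of_bool finite_subset[OF _ finE])
    also have "\<dots> = (\<Sum>A\<in>Pow E. \<Sum>c\<in>?F. (-1) ^ card A * of_bool (\<forall>e\<in>A. ?mono c e))"
      by (rule sum.swap)
    also have "\<dots> = (\<Sum>A\<in>Pow E. (-1) ^ card A * int k ^ card (component_set V A))"
    proof (rule sum.cong[OF refl])
      fix A assume A: "A \<in> Pow E"
      then have AV: "\<And>e. e \<in> A \<Longrightarrow> e \<subseteq> V" using E by (auto simp: simple_graph_def)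
      have "(\<Sum>c\<in>?F. (-1) ^ card A * (of_bool (\<forall>e\<in>A. ?mono c e) :: int))
        = (-1) ^ card A * int (card {c\<in>?F. \<forall>e\<in>A. ?mono c e})"
        unfolding sum_distrib_left[symmetric] using finF by (simp add: Int_def)
      also have "{c\<in>?F. \<forall>e\<in>A. ?mono c e} =
          {c \<in> ?F. \<forall>x\<in>V. \<forall>y\<in>V. {x, y} \<in> A \<longrightarrow> c x = c y}"
        using A mono_iff by auto
      finally show "(\<Sum>c\<in>?F. (-1) ^ card A * (of_bool (\<forall>e\<in>A. ?mono c e) :: int))
        = (-1) ^ card A * int k ^ card (component_set V A)"
        using card_monochromatic_colorings[OF V, of A k] AV by simp
    qed
    also have "\<dots> = poly ?p (int k)"
      by (simp add: poly_sum poly_monom)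
    finally show ?thesis by simp
  qed
  show ?thesis
    unfolding chromatic_poly_def
  proof (rule the_equality)
    fix q assume q: "\<forall>k. poly q (int k) = int (card (proper_colorings V E k))"
    \<comment> \<open>Uniqueness for the definite description: two polynomials agreeing at all
      naturals differ by one with infinitely many roots.\<close>
    have "range int \<subseteq> {x. poly (q - ?p) x = 0}"
      using q main by auto
    then have "infinite {x. poly (q - ?p) x = 0}"
      using finite_subset range_inj_infinite[of int] by auto
    then show "q = ?p" using poly_roots_finite[of "q - ?p"] by auto
  qed (use main in blast)
qed

section \<open>Dimension, vector matroid rank and coordinate vectors\<close>

text \<open>The ambient space may be infinite-dimensional, so the argument extends a basis chosen
  inside the finite set \<open>S\<close>.\<close>

lemma dim_insert_finite:
  assumes "finite S"
  shows "dim (insert x S) = (if x \<in> span S then dim S else Suc (dim S))"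
proof (cases "x \<in> span S")
  case True
  then have "span (insert x S) = span S" by (rule span_redundant)
  then have "dim (insert x S) = dim S" by (rule real_vector.span_eq_dim)
  then show ?thesis using True by simp
next
  case False
  obtain C where C: "C \<subseteq> S" "independent C" "S \<subseteq> span C" "card C = dim S"
    by (rule real_vector.basis_exists)
  have x: "x \<notin> span C" using False span_mono[OF C(1)] by blast
  then have "x \<notin> C" using span_base[of x C] by blast
  have "S \<subseteq> span (insert x C)" using C(3) span_mono[of C "insert x C"] by blast
  then have "insert x S \<subseteq> span (insert x C)"
    using span_base[of x "insert x C"] by simp
  moreover have "insert x C \<subseteq> insert x S" using C(1) by blast
  moreover have "independent (insert x C)" using x C(2) by (rule real_vector.independent_insertI)
  ultimately have "dim (insert x S) = card (insert x C)"
    by (intro real_vector.dim_unique[of "insert x C"] refl)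
  also have "\<dots> = Suc (dim S)"
    using \<open>x \<notin> C\<close> C finite_subset[OF C(1) assms] by simp
  finally show ?thesis using False by simp
qed

lemma dim_le_dim_finite:
  assumes "finite T" "S \<subseteq> span T"
  shows "dim S \<le> dim T"
proof -
  obtain C where C: "C \<subseteq> T" "independent C" "T \<subseteq> span C" "card C = dim T"
    by (rule real_vector.basis_exists)
  have "span T \<subseteq> span C" using C(3) subspace_span by (rule span_minimal)
  then have "S \<subseteq> span C" using assms(2) by (rule order_trans[rotated])
  then show ?thesis using real_vector.dim_le_card[of S C] C finite_subset[OF C(1) assms(1)] by simp
qed

text \<open>The rank counts labels, \<open>dim\<close> counts vectors. Independent label sets are
  injective under \<open>v\<close>, so a basis chosen inside the image of \<open>A\<close> lifts to
  labels, and no independent label set is larger.\<close>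

lemma matroid_rank_vector_matroid:
  assumes "finite A" "A \<subseteq> S"
  shows "matroid_rank (vector_matroid S v) A = dim (v ` A)"
proof -
  let ?I = "{I. I \<subseteq> A \<and> I \<subseteq> S \<and> inj_on v I \<and> independent (v ` I)}"
  obtain C where C: "C \<subseteq> v ` A" "independent C" "v ` A \<subseteq> span C" "card C = dim (v ` A)"
    by (rule real_vector.basis_exists)
  have "finite C" using C(1) assms(1) finite_surj by blast
  obtain I where I: "I \<subseteq> A" "inj_on v I" "C = v ` I" using C(1) by (auto simp: subset_image_inj)
  have "card I = dim (v ` A)" using I C(4) card_image[OF I(2)] by simp
  moreover have "I \<in> ?I" using I C(2) assms(2) by auto
  ultimately have "dim (v ` A) \<in> card ` ?I" by (metis (no_types) imageI)
  moreover have "card J \<le> dim (v ` A)" if "J \<in> ?I" for J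
  proof -
    have "v ` J \<subseteq> span C" using that C(3) by blast
    then have "card (v ` J) \<le> card C"
      using independent_span_bound[OF \<open>finite C\<close>] that by simp
    then show ?thesis using that C(4) by (simp add: card_image)
  qed
  moreover have "finite ?I" using assms(1) by simp
  ultimately have "Max (card ` ?I) = dim (v ` A)"
    by (intro Max_eqI finite_imageI) blast+
  then show ?thesis by (simp add: matroid_rank_def vector_matroid_def)
qed

lemma lookup_scaleR:
  "Poly_Mapping.lookup (c *\<^sub>R w) k = c *\<^sub>R Poly_Mapping.lookup w k"
  unfolding scaleR_poly_mapping_def
  by (subst Abs_poly_mapping_inverse)
    (auto intro: finite_subset[OF _ finite_lookup[of w]])

lemma lookup_eq_0_on_span:
  assumes "w \<in> span S" "\<And>v. v \<in> S \<Longrightarrow> Poly_Mapping.lookup v k = (0::real)"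
  shows "Poly_Mapping.lookup w k = 0"
  using assms(1) by (rule span_induct) (auto simp: subspace_def lookup_add assms(2) lookup_scaleR)

lemma independent_single:
  "finite K \<Longrightarrow> independent ((\<lambda>k. Poly_Mapping.single k (1::real)) ` K)"
proof (induction K rule: finite_induct)
  case (insert k K)
  have "Poly_Mapping.single k 1 \<notin> span ((\<lambda>k. Poly_Mapping.single k (1::real)) ` K)"
  proof
    assume "Poly_Mapping.single k 1 \<in> span ((\<lambda>k. Poly_Mapping.single k (1::real)) ` K)"
    then have "Poly_Mapping.lookup (Poly_Mapping.single k (1::real)) k = 0"
      by (rule lookup_eq_0_on_span) (use insert.hyps in \<open>auto simp: lookup_single when_def\<close>)
    then show False by simp
  qed
  then show ?case using insert.IH by (simp add: real_vector.independent_insertI)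
qed (simp add: real_vector.independent_empty)

lemma inj_single: "inj (\<lambda>k. Poly_Mapping.single k (1::real))"
proof (rule injI)
  fix k l assume "Poly_Mapping.single k (1::real) = Poly_Mapping.single l 1"
  then have "Poly_Mapping.lookup (Poly_Mapping.single l (1::real)) k = 1"
    using lookup_single_eq[of k "1::real"] by simp
  then show "k = l" by (simp add: lookup_single when_def split: if_splits)
qed

section \<open>Spans and ranks in the Dirichlet matroid\<close>

text \<open>Takes a component function rather than an edge set, so that it can serve as the
  predicate \<open>P\<close> of \<open>signed_component_sum_nonneg\<close>.\<close>

definition connects_boundary :: "'a set \<Rightarrow> ('a \<Rightarrow> 'a set) \<Rightarrow> bool" where
  "connects_boundary B C \<longleftrightarrow> (\<exists>x\<in>B. \<exists>y\<in>B. x \<noteq> y \<and> y \<in> C x)"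

lemma connects_boundary_mono:
  "connects_boundary B (component A) \<Longrightarrow> A \<subseteq> A' \<Longrightarrow> connects_boundary B (component A')"
  unfolding connects_boundary_def by (meson component_mono subsetD)

text \<open>Placing boundary nodes on the \<open>e\<^sub>0\<close> axis makes every edge vector, of
  either kind, a difference of two vertex vectors.\<close>

definition vertex_vec :: "'a set \<Rightarrow> ('a \<Rightarrow> real) \<Rightarrow> 'a \<Rightarrow> 'a option \<Rightarrow>\<^sub>0 real" where
  "vertex_vec B u x = (if x \<in> B then u x *\<^sub>R basis_vec None else basis_vec (Some x))"

text \<open>A linear functional given by its coefficients. Such functionals certify that a vector
  lies outside a span.\<close>

definition pairing :: "'k set \<Rightarrow> ('k \<Rightarrow> real) \<Rightarrow> ('k \<Rightarrow>\<^sub>0 real) \<Rightarrow> real" where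
  "pairing K f w = (\<Sum>k\<in>K. Poly_Mapping.lookup w k * f k)"

lemma linear_pairing: "linear (pairing K f)"
  by (rule linearI)
    (simp_all add: pairing_def lookup_add lookup_scaleR distrib_right sum.distrib sum_distrib_left mult.assoc)

lemma pairing_single:
  assumes "finite K" "k \<in> K"
  shows "pairing K f (Poly_Mapping.single k 1) = f k"
proof -
  have "pairing K f (Poly_Mapping.single k 1) = (\<Sum>l\<in>K. if k = l then f l else 0)"
    unfolding pairing_def by (intro sum.cong refl) (simp add: lookup_single when_def)
  then show ?thesis using assms by simp
qed

locale dirichlet_network =
  fixes V B :: "'a set" and E :: "'a set set" and u :: "'a \<Rightarrow> real"
  assumes network: "network V E B" and u: "inj_on u B"
begin

abbreviation edge_vecs :: "'a set set \<Rightarrow> ('a option \<Rightarrow>\<^sub>0 real) set" where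
  "edge_vecs A \<equiv> dirichlet_vec V B u ` Some ` A"

text \<open>
  The functional \<open>potential t h\<close> takes the value \<open>\<plusminus>(h i - h j)\<close> on the vector of an edge \<open>{i, j}\<close>,
  provided that \<open>h = t * u\<close> on the boundary.
\<close>

abbreviation potential :: "real \<Rightarrow> ('a \<Rightarrow> real) \<Rightarrow> ('a option \<Rightarrow>\<^sub>0 real) \<Rightarrow> real" where
  "potential t h \<equiv> pairing (insert None (Some ` V)) (case_option t h)"

lemma finite_V: "finite V" and simple: "simple_graph V E" and B_subset: "B \<subseteq> V"
  using network by (auto simp: network_def)

lemma finite_B: "finite B"
  using finite_subset[OF B_subset finite_V] .

lemma finite_E: "finite E"
  using simple finite_V finite_subset[of E "Pow V"] by (auto simp: simple_graph_def)

text \<open>Settles the choice operator once: whichever candidate is picked, it is a difference of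
  vertex vectors for some orientation of the edge.\<close>

lemma edge_cases:
  assumes "e \<in> E"
  obtains i j where "i \<in> V" "j \<in> V" "i \<notin> B" "e = {i, j}"
    "dirichlet_vec V B u (Some e) = vertex_vec B u i - vertex_vec B u j"
proof -
  have "e \<subseteq> V" "card e = 2" using assms simple by (auto simp: simple_graph_def)
  then obtain x y where xy: "e = {x, y}" "x \<in> V" "y \<in> V"
    unfolding card_2_iff by blast
  \<comment> \<open>Boundary nodes are not adjacent, so some end is interior; hence a candidate
    exists for the choice.\<close>
  have "\<not> (x \<in> B \<and> y \<in> B)" using assms network unfolding xy network_def by blast
  then obtain i j where ij: "e = {i, j}" "i \<in> V" "j \<in> V" "i \<notin> B"
    using xy by (metis insert_commute)
  define Q where "Q w \<longleftrightarrow>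
    (\<exists>i\<in>V - B. \<exists>j\<in>V - B. e = {i, j} \<and> w = basis_vec (Some i) - basis_vec (Some j)) \<or>
    (\<exists>i\<in>V - B. \<exists>j\<in>B. e = {i, j} \<and> w = basis_vec (Some i) - u j *\<^sub>R basis_vec None)" for w
  have "Q (basis_vec (Some i) - basis_vec (Some j)) \<or> Q (basis_vec (Some i) - u j *\<^sub>R basis_vec None)"
    using ij unfolding Q_def by blast
  then have "Q (SOME w. Q w)" by (metis someI)
  then have Q: "Q (dirichlet_vec V B u (Some e))"
    unfolding dirichlet_vec.simps Q_def .
  show thesis
    using Q unfolding Q_def
  proof (elim disjE bexE conjE)
    fix k l assume "k \<in> V - B" "l \<in> V - B" "e = {k, l}"
      "dirichlet_vec V B u (Some e) = basis_vec (Some k) - basis_vec (Some l)"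
    then show thesis by (intro that[of k l]) (auto simp: vertex_vec_def)
  next
    fix k l assume "k \<in> V - B" "l \<in> B" "e = {k, l}"
      "dirichlet_vec V B u (Some e) = basis_vec (Some k) - u l *\<^sub>R basis_vec None"
    then show thesis using B_subset by (intro that[of k l]) (auto simp: vertex_vec_def)
  qed
qed

lemma potential_vertex_vec:
  assumes "x \<in> V" "\<And>b. b \<in> B \<Longrightarrow> h b = u b * t"
  shows "potential t h (vertex_vec B u x) = h x"
  using assms finite_V
  by (simp add: vertex_vec_def pairing_single linear_scale[OF linear_pairing])

text \<open>The absolute values absorb the unknown orientation of the edge vector.\<close>

lemma potential_edge_vec:
  assumes "{i, j} \<in> E" "\<And>b. b \<in> B \<Longrightarrow> h b = u b * t"
  shows "\<bar>potential t h (dirichlet_vec V B u (Some {i, j}))\<bar> = \<bar>h i - h j\<bar>"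
proof -
  obtain k l where kl: "k \<in> V" "l \<in> V" "{i, j} = {k, l}"
    "dirichlet_vec V B u (Some {i, j}) = vertex_vec B u k - vertex_vec B u l"
    using assms(1) by (rule edge_cases)
  have "potential t h (dirichlet_vec V B u (Some {i, j})) = h k - h l"
    unfolding kl(4) linear_diff[OF linear_pairing] using kl(1,2) assms(2)
    by (simp add: potential_vertex_vec)
  moreover have "\<bar>h k - h l\<bar> = \<bar>h i - h j\<bar>"
    using kl(3) by (auto simp: doubleton_eq_iff)
  ultimately show ?thesis by simp
qed

lemma potential_eq_0_on_span:
  assumes "A \<subseteq> E" "\<And>b. b \<in> B \<Longrightarrow> h b = u b * t" "\<And>x y. {x, y} \<in> A \<Longrightarrow> h x = h y"
    "w \<in> span (edge_vecs A)"
  shows "potential t h w = 0"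
proof (rule linear_eq_0_on_span[OF linear_pairing _ assms(4)])
  fix v assume "v \<in> edge_vecs A"
  then obtain e where e: "e \<in> A" "v = dirichlet_vec V B u (Some e)" by blast
  then obtain i j where ij: "e = {i, j}" using assms(1) edge_cases[of e] by blast
  then have "\<bar>potential t h v\<bar> = \<bar>h i - h j\<bar>"
    using potential_edge_vec[of i j h t] e assms(1,2) by auto
  then show "potential t h v = 0" using assms(3)[of i j] e ij by simp
qed

text \<open>The suitably signed edge vectors along a walk from \<open>x\<close> to \<open>y\<close>
  telescope.\<close>

lemma vertex_vec_diff_in_span:
  assumes "A \<subseteq> E" "y \<in> component A x"
  shows "vertex_vec B u y - vertex_vec B u x \<in> span (edge_vecs A)"
proof -
  have "component A x \<subseteq> {y. vertex_vec B u y - vertex_vec B u x \<in> span (edge_vecs A)}"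
  proof (rule component_subset)
    fix y z
    assume y: "y \<in> {y. vertex_vec B u y - vertex_vec B u x \<in> span (edge_vecs A)}"
      and yz: "{y, z} \<in> A"
    have "{y, z} \<in> E" using yz assms(1) by blast
    then obtain i j where ij: "{y, z} = {i, j}"
      "dirichlet_vec V B u (Some {y, z}) = vertex_vec B u i - vertex_vec B u j"
      by (rule edge_cases)
    have e: "dirichlet_vec V B u (Some {y, z}) \<in> span (edge_vecs A)"
      using yz by (intro span_base imageI)
    have "(z = i \<and> y = j) \<or> (z = j \<and> y = i)" using ij(1) by (auto simp: doubleton_eq_iff)
    then have "vertex_vec B u z - vertex_vec B u y \<in> span (edge_vecs A)"
    proof (elim disjE conjE)
      assume "z = i" "y = j"
      then show ?thesis using e ij(2) by simp
    next
      assume "z = j" "y = i"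
      then have "vertex_vec B u z - vertex_vec B u y = - dirichlet_vec V B u (Some {y, z})"
        unfolding ij(2) by simp
      then show ?thesis using span_neg[OF e] by simp
    qed
    then have "(vertex_vec B u z - vertex_vec B u y) + (vertex_vec B u y - vertex_vec B u x)
        \<in> span (edge_vecs A)"
      using y by (intro span_add) simp_all
    then show "z \<in> {y. vertex_vec B u y - vertex_vec B u x \<in> span (edge_vecs A)}" by simp
  qed (simp add: span_zero)
  then show ?thesis using assms(2) by blast
qed

lemma e0_in_span_iff:
  assumes A: "A \<subseteq> E"
  shows "basis_vec None \<in> span (edge_vecs A) \<longleftrightarrow> connects_boundary B (component A)"
proof
  assume "connects_boundary B (component A)"
  then obtain x y where xy: "x \<in> B" "y \<in> B" "x \<noteq> y" "y \<in> component A x"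
    unfolding connects_boundary_def by blast
  \<comment> \<open>Injectivity of \<open>u\<close> enters here: two connected boundary nodes yield
    a nonzero multiple of \<open>e\<^sub>0\<close>.\<close>
  have "u y - u x \<noteq> 0" using inj_onD[OF u, of y x] xy by auto
  have "vertex_vec B u y - vertex_vec B u x = (u y - u x) *\<^sub>R basis_vec None"
    using xy(1,2) by (simp add: vertex_vec_def scaleR_diff_left)
  then have "(u y - u x) *\<^sub>R basis_vec None \<in> span (edge_vecs A)"
    using vertex_vec_diff_in_span[OF A xy(4)] by simp
  then have "inverse (u y - u x) *\<^sub>R (u y - u x) *\<^sub>R basis_vec None \<in> span (edge_vecs A)"
    by (rule span_scale)
  then show "basis_vec None \<in> span (edge_vecs A)"
    using \<open>u y - u x \<noteq> 0\<close> by simp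
next
  assume e0: "basis_vec None \<in> span (edge_vecs A)"
  show "connects_boundary B (component A)"
  proof (rule ccontr)
    assume sep: "\<not> connects_boundary B (component A)"
    \<comment> \<open>Giving every component the value of \<open>u\<close> at its only boundary node defines a functional
      that vanishes on the edge vectors but not on \<open>e\<^sub>0\<close>.\<close>
    define h where "h x = (\<Sum>b\<in>B. if x \<in> component A b then u b else 0)" for x
    have "h b = u b * 1" if "b \<in> B" for b
    proof -
      have "h b = (\<Sum>b'\<in>B. if b' = b then u b' else 0)"
        unfolding h_def using sep that component_refl[of b A]
        by (intro sum.cong refl) (auto simp: connects_boundary_def)
      then show ?thesis using that finite_B by simp
    qed
    moreover have "h x = h y" if "{x, y} \<in> A" for x y
    proof -
      have "x \<in> component A b \<longleftrightarrow> y \<in> component A b" for b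
        using component_edge[OF that] component_sym[of y A x] component_trans[of _ A b] by blast
      then show ?thesis by (simp add: h_def)
    qed
    ultimately have "potential 1 h (basis_vec None) = 0"
      using potential_eq_0_on_span[OF A _ _ e0, of h 1] by blast
    then show False using finite_V by (simp add: pairing_single)
  qed
qed

text \<open>The component of one end avoids \<open>B\<close>, since otherwise the new edge would
  join two boundary nodes. The indicator of that component is a potential that kills the edges of
  \<open>A\<close> but not the new one.\<close>

lemma edge_vec_notin_span:
  assumes A: "A \<subseteq> E" and e: "{i, j} \<in> E" and j: "j \<notin> component A i"
    and sep: "\<not> connects_boundary B (component (insert {i, j} A))"
  shows "dirichlet_vec V B u (Some {i, j}) \<notin> span (edge_vecs A)"
proof
  assume span: "dirichlet_vec V B u (Some {i, j}) \<in> span (edge_vecs A)"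
  \<comment> \<open>Stated for either orientation of the edge, as it is not known in advance which
    end has a component avoiding \<open>B\<close>.\<close>
  have False if B: "B \<inter> component A k = {}" and kl: "{i, j} = {k, l}" "l \<notin> component A k" for k l
  proof -
    define h where "h x = (if x \<in> component A k then 1 else 0 :: real)" for x
    have h0: "h b = u b * 0" if "b \<in> B" for b
      \<comment> \<open>The indicator vanishes on \<open>B\<close>, so it is compatible with
        \<open>t = 0\<close>.\<close>
      using that B by (auto simp: h_def)
    moreover have "h x = h y" if "{x, y} \<in> A" for x y
    proof -
      have "x \<in> component A k \<longleftrightarrow> y \<in> component A k"
        using component_edge[OF that] component_sym[of y A x] component_trans[of _ A k] by blast
      then show ?thesis by (simp add: h_def)
    qed
    ultimately have "potential 0 h (dirichlet_vec V B u (Some {k, l})) = 0"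
      using potential_eq_0_on_span[OF A _ _ span, of h 0] unfolding kl(1) by blast
    then have "h k - h l = 0"
      using potential_edge_vec[of k l h 0] e h0 unfolding kl(1) by simp
    then show False using kl(2) by (simp add: h_def)
  qed
  from this[of i j] this[of j i]
  obtain b b' where b: "b \<in> B" "b \<in> component A i" "b' \<in> B" "b' \<in> component A j"
    using j component_sym[of i A j] by (auto simp: insert_commute)
  have "b \<noteq> b'"
    using b component_sym[of b' A j] component_trans[of b A i j] j by blast
  moreover have "b' \<in> component (insert {i, j} A) b"
    unfolding component_insert using b by simp
  ultimately show False using sep b unfolding connects_boundary_def by blast
qed

text \<open>As long as no two boundary nodes are connected, the vectors behave as in the graphic
  matroid: a new edge raises the dimension exactly when it merges two components.\<close>

lemma dim_edge_vecs:
  assumes "A \<subseteq> E" "\<not> connects_boundary B (component A)"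
  shows "dim (edge_vecs A) + card (component_set V A) = card V"
proof -
  have "finite A" using assms(1) finite_E by (rule finite_subset)
  then show ?thesis using assms
  proof (induction A rule: finite_induct)
    case empty
    have "dim ({} :: ('a option \<Rightarrow>\<^sub>0 real) set) = 0"
      using real_vector.dim_le_card[of "{}" "{}"] by simp
    then show ?case by (simp add: card_component_set_empty)
  next
    case (insert e A)
    have A: "A \<subseteq> E" "e \<in> E" using insert.prems(1) by auto
    have "\<not> connects_boundary B (component A)"
      using insert.prems(2) connects_boundary_mono[of B A "insert e A"] by blast
    then have IH: "dim (edge_vecs A) + card (component_set V A) = card V"
      using insert.IH A(1) by blast
    obtain i j where ij: "i \<in> V" "j \<in> V" "e = {i, j}"
      "dirichlet_vec V B u (Some e) = vertex_vec B u i - vertex_vec B u j"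
      using A(2) by (rule edge_cases)
    have "dirichlet_vec V B u (Some e) \<in> span (edge_vecs A) \<longleftrightarrow> j \<in> component A i"
    proof
      assume "j \<in> component A i"
      then show "dirichlet_vec V B u (Some e) \<in> span (edge_vecs A)"
        unfolding ij(4) using vertex_vec_diff_in_span[OF A(1) component_sym] by blast
    next
      assume "dirichlet_vec V B u (Some e) \<in> span (edge_vecs A)"
      then show "j \<in> component A i"
        using edge_vec_notin_span[OF A(1), of i j] A(2) insert.prems(2) unfolding ij(3) by blast
    qed
    moreover have "dim (edge_vecs (insert e A)) =
        (if dirichlet_vec V B u (Some e) \<in> span (edge_vecs A) then dim (edge_vecs A)
         else Suc (dim (edge_vecs A)))"
      unfolding image_insert using insert.hyps(1) by (intro dim_insert_finite finite_imageI)
    ultimately show ?case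
      using IH card_component_set_insert[OF finite_V ij(1,2), of A] unfolding ij(3)[symmetric]
      by (simp split: if_splits)
  qed
qed

text \<open>The vectors span the whole coordinate space. Starting from a boundary node, whose vector
  is a multiple of \<open>e\<^sub>0\<close>, connectedness reaches the unit vector of every interior
  vertex.\<close>

lemma dim_all_vecs:
  "dim (insert (basis_vec None) (edge_vecs E)) = Suc (card (V - B))"
proof -
  let ?S = "insert (basis_vec None) (edge_vecs E)"
  let ?K = "insert None (Some ` (V - B))"
  let ?T = "basis_vec ` ?K"
  have e0S: "basis_vec None \<in> span ?S" by (intro span_base insertI1)
  have e0T: "basis_vec None \<in> span ?T" by (intro span_base imageI insertI1)
  have "B \<noteq> {}" using network unfolding network_def by (metis card.empty not_numeral_le_zero)
  then obtain b where b: "b \<in> B" by blast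
  have bS: "vertex_vec B u b \<in> span ?S"
    using b span_scale[OF e0S] by (simp add: vertex_vec_def)
  have "basis_vec (Some x) \<in> span ?S" if x: "x \<in> V - B" for x
  proof -
    have "b \<in> V" using b B_subset by blast
    then obtain p where p: "graph_path V E p" "hd p = b" "last p = x"
      using network x unfolding network_def graph_connected_def by blast
    then have "x \<in> component E b"
      using component_of_path[of E p] by (auto simp: graph_path_def)
    then have "vertex_vec B u x - vertex_vec B u b \<in> span (edge_vecs E)"
      by (rule vertex_vec_diff_in_span[OF order_refl])
    then have "vertex_vec B u x - vertex_vec B u b \<in> span ?S"
      using span_mono[of "edge_vecs E" ?S] by blast
    then have "(vertex_vec B u x - vertex_vec B u b) + vertex_vec B u b \<in> span ?S"
      using bS by (rule span_add)
    then show ?thesis using x by (simp add: vertex_vec_def)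
  qed
  then have TS: "?T \<subseteq> span ?S" using e0S by auto
  have v: "vertex_vec B u x \<in> span ?T" if "x \<in> V" for x
  proof (cases "x \<in> B")
    case True
    then show ?thesis using span_scale[OF e0T] by (simp add: vertex_vec_def)
  next
    case False
    then have "basis_vec (Some x) \<in> ?T" using that by (intro imageI) simp
    then have "basis_vec (Some x) \<in> span ?T" by (rule span_base)
    then show ?thesis unfolding vertex_vec_def if_not_P[OF False] .
  qed
  have "dirichlet_vec V B u (Some e) \<in> span ?T" if "e \<in> E" for e
  proof -
    obtain i j where ij: "i \<in> V" "j \<in> V"
      "dirichlet_vec V B u (Some e) = vertex_vec B u i - vertex_vec B u j"
      using \<open>e \<in> E\<close> by (rule edge_cases)
    show ?thesis unfolding ij(3) by (intro span_diff v ij)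
  qed
  then have ST: "?S \<subseteq> span ?T" using e0T by auto
  have "span ?S = span ?T"
    using span_minimal[OF ST] span_minimal[OF TS] by simp
  then have "dim ?S = dim ?T" by (rule real_vector.span_eq_dim)
  also have "\<dots> = card ?T"
    using finite_V by (intro real_vector.dim_eq_card_independent independent_single) simp
  also have "\<dots> = card ?K" by (rule card_image) (rule inj_on_subset[OF inj_single subset_UNIV])
  also have "\<dots> = Suc (card (V - B))" using finite_V by (simp add: card_image)
  finally show ?thesis .
qed

text \<open>Here \<open>e\<^sub>0\<close> is outside the span, so adjoining it raises the dimension
  by one, still within the full rank. The bound keeps the natural-number subtractions in the
  exponents from truncating.\<close>

lemma rank_le_interior:
  assumes "A \<subseteq> E" "\<not> connects_boundary B (component A)"
  shows "dim (edge_vecs A) \<le> card (V - B)"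
proof -
  have fin: "finite (edge_vecs A)" using assms(1) finite_E finite_subset by blast
  have "Suc (dim (edge_vecs A)) = dim (insert (basis_vec None) (edge_vecs A))"
    using assms e0_in_span_iff[OF assms(1)] by (simp add: dim_insert_finite[OF fin])
  also have "\<dots> \<le> dim (insert (basis_vec None) (edge_vecs E))"
    using assms(1) finite_E by (intro dim_le_dim_finite) (auto intro: span_base)
  finally show ?thesis using dim_all_vecs by simp
qed

section \<open>Subset expansion of the precoloring polynomial\<close>

lemma precoloring_poly_expansion:
  "precoloring_poly V E B u =
    (\<Sum>A\<in>{A\<in>Pow E. \<not> connects_boundary B (component A)}.
      monom ((-1) ^ card A) (card (V - B) + card (component_set V A) - card V))"
    (is "_ = ?p")
proof -
  let ?M = "dirichlet_matroid V E B u" and ?n = "card (V - B)"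
  let ?r = "\<lambda>A. dim (edge_vecs A)"
  let ?sep = "\<lambda>A. \<not> connects_boundary B (component A)"
  have M: "fst ?M = insert None (Some ` E)"
    by (simp add: dirichlet_matroid_def vector_matroid_def)
  have rank: "matroid_rank ?M X = dim (dirichlet_vec V B u ` X)" if "X \<subseteq> insert None (Some ` E)" for X
    unfolding dirichlet_matroid_def using that finite_E finite_subset
    by (intro matroid_rank_vector_matroid) (auto intro: finite_subset)
  have rank_M: "matroid_rank ?M (fst ?M) = Suc ?n"
    using rank[of "insert None (Some ` E)"] dim_all_vecs unfolding M by simp
  let ?t = "\<lambda>X. monom ((-1) ^ card X) (matroid_rank ?M (fst ?M) - matroid_rank ?M X) :: int poly"
  \<comment> \<open>Ground set subsets are paired by whether they contain
    \<open>e\<^sub>0\<close>.\<close>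
  have "characteristic_poly ?M = sum ?t (Pow (Some ` E) \<union> insert None ` Pow (Some ` E))"
    unfolding characteristic_poly_def M Pow_insert ..
  also have "\<dots> = sum ?t (Pow (Some ` E)) + sum ?t (insert None ` Pow (Some ` E))"
    using finite_E by (intro sum.union_disjoint) auto
  also have "sum ?t (insert None ` Pow (Some ` E)) = (\<Sum>X\<in>Pow (Some ` E). ?t (insert None X))"
    by (subst sum.reindex) (auto simp: inj_on_def)
  also have "sum ?t (Pow (Some ` E)) + \<dots> = (\<Sum>X\<in>Pow (Some ` E). ?t X + ?t (insert None X))"
    by (rule sum.distrib[symmetric])
  also have "\<dots> = (\<Sum>A\<in>Pow E. ?t (Some ` A) + ?t (insert None (Some ` A)))"
    unfolding image_Pow_surj[OF refl, symmetric]
    by (subst sum.reindex) (auto simp: inj_on_def inj_image_eq_iff)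
  \<comment> \<open>Each pair that does not cancel carries a factor \<lambda> - 1, the very factor
    divided out in the reduced polynomial.\<close>
  also have "\<dots> = (\<Sum>A\<in>Pow E. if ?sep A then
      monom ((-1) ^ card A) (?n + card (component_set V A) - card V) * [:-1, 1:] else 0)"
  proof (rule sum.cong[OF refl])
    fix A assume "A \<in> Pow E"
    then have A: "A \<subseteq> E" and fin: "finite A" using finite_E finite_subset by auto
    have card1: "card (Some ` A) = card A" by (simp add: card_image)
    have card2: "card (insert None (Some ` A)) = Suc (card A)" using fin card1 by simp
    have r1: "matroid_rank ?M (Some ` A) = ?r A" using rank A by blast
    have "matroid_rank ?M (insert None (Some ` A)) = dim (insert (basis_vec None) (edge_vecs A))"
      using rank[of "insert None (Some ` A)"] A by auto
    then have r2: "matroid_rank ?M (insert None (Some ` A)) = (if ?sep A then Suc (?r A) else ?r A)"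
      using e0_in_span_iff[OF A] fin by (simp add: dim_insert_finite)
    show "?t (Some ` A) + ?t (insert None (Some ` A)) = (if ?sep A then
      monom ((-1) ^ card A) (?n + card (component_set V A) - card V) * [:-1, 1:] else 0)"
    proof (cases "?sep A")
      case False
      then show ?thesis unfolding card1 card2 r1 r2 by (simp add: add_monom)
    next
      case True
      have "?n + card (component_set V A) - card V = ?n - ?r A"
        using dim_edge_vecs[OF A True] by linarith
      \<comment> \<open>The term without \<open>e\<^sub>0\<close> has degree one higher than its
        partner; this needs the rank to be at most \<open>?n\<close>.\<close>
      moreover have "Suc ?n - ?r A = Suc (?n - ?r A)"
        using rank_le_interior[OF A True] by simp
      ultimately show ?thesis
        using True unfolding card1 card2 r1 r2 rank_M
        by (simp add: monom_Suc minus_monom flip: smult_monom)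
    qed
  qed
  also have "\<dots> = ?p * [:-1, 1:]"
    unfolding sum_distrib_right using finite_E by (intro sum.inter_filter[symmetric]) simp
  finally have "characteristic_poly ?M = ?p * [:-1, 1:]" .
  then show ?thesis
    unfolding precoloring_poly_def reduced_characteristic_poly_def
    by (simp only: nonzero_mult_div_cancel_right pCons_eq_0_iff one_neq_zero simp_thms)
qed

end

section \<open>Comparison of the two polynomials\<close>

text \<open>A path in \<open>A\<close> between boundary nodes lies in one component and is also a
  path in \<open>E\<close>. It has one vertex more than edges, which accounts for the
  \<open>Suc\<close> in the component bound.\<close>

lemma boundary_distance_le:
  assumes "finite V" "A \<subseteq> E" "\<Union>E \<subseteq> V" "B \<subseteq> V" "connects_boundary B (component A)"
  shows "boundary_distance V E B + card (component_set V A) \<le> card V"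
proof -
  obtain x y where xy: "x \<in> B" "y \<in> B" "x \<noteq> y" "y \<in> component A x"
    using assms(5) unfolding connects_boundary_def by blast
  have "x \<in> V" using xy(1) assms(4) by blast
  obtain p where p: "graph_path V A p" "hd p = x" "last p = y" "set p \<subseteq> component A x"
    using component_path[OF xy(4) \<open>x \<in> V\<close>] assms(2,3) by blast
  have "graph_path V E p"
    using p(1) assms(2) unfolding graph_path_def
    by (auto elim!: successively_mono)
  then have "boundary_distance V E B \<le> length p - 1"
    unfolding boundary_distance_def using p(2,3) xy(1-3) by (intro Least_le exI[of _ p]) simp
  moreover have "p \<noteq> []" "set p \<subseteq> V" "card (set p) = length p"
    using p(1) by (auto simp: graph_path_def distinct_card)
  moreover have "card (component_set V A) + card (set p) \<le> Suc (card V)"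
    using assms(1) \<open>x \<in> V\<close> \<open>set p \<subseteq> V\<close> p(4) by (rule card_component_set_add_card_component_le)
  moreover have "length p \<noteq> 0" using \<open>p \<noteq> []\<close> by simp
  ultimately show ?thesis by linarith
qed

text \<open>The signs cancel in pairs and the index is reversed; the degree bound ensures that no
  coefficient is missed.\<close>

lemma poly_eq_sum_signed_monoms:
  fixes p :: "int poly"
  assumes "degree p \<le> m" "\<And>i. a i = (-1) ^ i * coeff p (m - i)"
  shows "p = (\<Sum>i\<le>m. monom ((-1) ^ i * a i) (m - i))"
proof -
  have "(\<Sum>i\<le>m. monom ((-1) ^ i * a i) (m - i)) = (\<Sum>i\<le>m. monom (coeff p (m - i)) (m - i))"
    by (simp add: assms(2) flip: mult.assoc power_add mult_2)
  also have "\<dots> = (\<Sum>i\<le>m. monom (coeff p i) i)"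
    by (rule sum.reindex_bij_witness[of _ "\<lambda>i. m - i" "\<lambda>i. m - i"]) auto
  finally show ?thesis using poly_as_sum_of_monoms'[OF assms(1)] by simp
qed

text \<open>As \<open>a\<close> and \<open>b\<close> are read off with \<open>coeff\<close>, the
  first two conjuncts record that the signed sums are the complete polynomials.\<close>

theorem theorem1p2:
  fixes V B :: "'a set" and E :: "'a set set" and u :: "'a \<Rightarrow> real"
    and d n :: nat and a b :: "nat \<Rightarrow> int"
  assumes network: "network V E B"
    and u: "inj_on u B"
    and d: "d = card V"
    and n: "n = card (V - B)"
    and a: "\<And>i. a i = (-1) ^ i * coeff (chromatic_poly V E) (d - i)"
    and b: "\<And>i. b i = (-1) ^ i * coeff (precoloring_poly V E B u) (n - i)"
  shows "chromatic_poly V E = (\<Sum>i\<le>d. monom ((-1) ^ i * a i) (d - i)) \<and>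
    precoloring_poly V E B u = (\<Sum>i\<le>n. monom ((-1) ^ i * b i) (n - i)) \<and>
    (\<forall>i\<le>n. a i \<ge> b i) \<and>
    (\<forall>i\<le>n. i < boundary_distance V E B \<longrightarrow> a i = b i)"
proof -
  interpret dirichlet_network V B E u
    using network u by unfold_locales
  let ?c = "\<lambda>A. card (component_set V A)"
  let ?bad = "\<lambda>A. connects_boundary B (component A)"
  note chromatic = chromatic_poly_expansion[OF finite_V simple]
  note precoloring = precoloring_poly_expansion
  have c_le: "?c A \<le> d" for A unfolding d using finite_V by (rule card_component_set_le)
  have "n \<le> d" unfolding n d using finite_V by (intro card_mono) auto
  have deg_chromatic: "degree (chromatic_poly V E) \<le> d"
    unfolding chromatic using finite_E c_le
    by (intro degree_sum_le) (auto intro: order_trans[OF degree_monom_le])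
  have deg_precoloring: "degree (precoloring_poly V E B u) \<le> n"
    unfolding precoloring
  proof (intro degree_sum_le)
    fix A
    have "card (V - B) + ?c A - card V \<le> n" using c_le[of A] n d by linarith
    then show "degree (monom ((-1) ^ card A :: int) (card (V - B) + ?c A - card V)) \<le> n"
      by (rule order_trans[OF degree_monom_le])
  qed (use finite_E in simp)
  have diff: "a i - b i = (-1) ^ i * (\<Sum>A\<in>{A\<in>Pow E. ?bad A \<and> ?c A = d - i}. (-1) ^ card A)"
    if i: "i \<le> n" for i
  proof -
    have "coeff (chromatic_poly V E) (d - i) = (\<Sum>A\<in>{A\<in>Pow E. ?c A = d - i}. (-1) ^ card A)"
      unfolding chromatic coeff_sum coeff_monom using finite_E
      by (intro sum.inter_filter[symmetric]) simp
    also have "\<dots> = (\<Sum>A\<in>{A\<in>Pow E. ?bad A \<and> ?c A = d - i} \<union>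
        {A\<in>Pow E. \<not> ?bad A \<and> ?c A = d - i}. (-1) ^ card A)"
      by (intro sum.cong refl) blast
    also have "\<dots> = (\<Sum>A\<in>{A\<in>Pow E. ?bad A \<and> ?c A = d - i}. (-1) ^ card A) +
        (\<Sum>A\<in>{A\<in>Pow E. \<not> ?bad A \<and> ?c A = d - i}. (-1) ^ card A)"
      using finite_E by (intro sum.union_disjoint) auto
    also have "(\<Sum>A\<in>{A\<in>Pow E. \<not> ?bad A \<and> ?c A = d - i}. (-1) ^ card A) =
        coeff (precoloring_poly V E B u) (n - i)"
    proof -
      \<comment> \<open>By the rank formula \<open>d - ?c A\<close> is a rank of at most
        \<open>n\<close>, so \<open>n + ?c A - d\<close> does not truncate and both equations say
        that this rank is \<open>i\<close>.\<close>
      have "n + ?c A - d = n - i \<longleftrightarrow> ?c A = d - i" if "A \<in> {A\<in>Pow E. \<not> ?bad A}" for A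
        using dim_edge_vecs[of A] rank_le_interior[of A] that i \<open>n \<le> d\<close> unfolding n d by auto
      then have "coeff (precoloring_poly V E B u) (n - i) =
          (\<Sum>A\<in>{A\<in>Pow E. \<not> ?bad A}. if ?c A = d - i then (-1) ^ card A else 0)"
        unfolding precoloring coeff_sum coeff_monom n[symmetric] d[symmetric]
        by (intro sum.cong refl) auto
      also have "\<dots> = (\<Sum>A\<in>{A\<in>{A\<in>Pow E. \<not> ?bad A}. ?c A = d - i}. (-1) ^ card A)"
        using finite_E by (intro sum.inter_filter[symmetric]) simp
      also have "{A\<in>{A\<in>Pow E. \<not> ?bad A}. ?c A = d - i} = {A\<in>Pow E. \<not> ?bad A \<and> ?c A = d - i}"
        by blast
      finally show ?thesis ..
    qed
    finally show ?thesis unfolding a b by (simp add: algebra_simps)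
  qed
  have edges: "\<exists>i\<in>V. \<exists>j\<in>V. e = {i, j}" if "e \<in> E" for e
    using edge_cases[OF that] by metis
  have "b i \<le> a i" if i: "i \<le> n" for i
  proof -
    \<comment> \<open>Nothing is contracted at the start, so \<open>W\<close> is empty and has
      \<open>d\<close> singleton components; the exponent has the parity of
      \<open>i\<close>.\<close>
    have "0 \<le> (-1) ^ (d + (d - i)) * (\<Sum>A\<in>{A\<in>Pow E. ?bad A \<and> ?c A = d - i}. (-1::int) ^ card A)"
      using signed_component_sum_nonneg[OF finite_V finite_E edges, of "{}" "d - i" "connects_boundary B"]
      by (simp add: card_component_set_empty d)
    moreover have "even (d + (d - i) + i)" using i \<open>n \<le> d\<close> by simp
    then have "(-1::int) ^ (d + (d - i)) = (-1) ^ i"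
      by (metis even_add minus_one_power_iff)
    ultimately show ?thesis using diff[OF i] by simp
  qed
  moreover have "a i = b i" if i: "i \<le> n" "i < boundary_distance V E B" for i
  proof -
    have "\<Union>E \<subseteq> V" using simple by (auto simp: simple_graph_def)
    \<comment> \<open>Connecting two boundary nodes forces at most \<open>d\<close> minus the
      boundary distance components, which is less than \<open>d - i\<close>.\<close>
    have "?c A \<noteq> d - i" if "A \<subseteq> E" "?bad A" for A
      using boundary_distance_le[OF finite_V that(1) \<open>\<Union>E \<subseteq> V\<close> B_subset that(2)] i \<open>n \<le> d\<close> d
      by linarith
    then have none: "{A\<in>Pow E. ?bad A \<and> ?c A = d - i} = {}" by blast
    have "a i - b i = 0" unfolding diff[OF i(1)] none by simp
    then show ?thesis by simp
  qed
  ultimately show ?thesis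
    using poly_eq_sum_signed_monoms[OF deg_chromatic a] poly_eq_sum_signed_monoms[OF deg_precoloring b]
    by blast
qed

end
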